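(* Let $\mathcal{D}$ be a collection of families of nonempty subsets of $X$ which is inclusion closed. Let $\varphi$ be a continuous cocycle on $X$ over $\mathbb{R}$ and $(\Omega,\mathcal{F},P,\{\vartheta_t\}_{t\in\mathbb{R}})$. Assume that (i) $\varphi$ has a closed and measurable (with respect to the $P$-completion of $\mathcal{F}$) $\mathcal{D}$-pullback absorbing set $K=\{K(\tau,\omega);\tau\in\mathbb{R},\omega\in\Omega\}\in\mathcal{D}$ in $X$; (ii) $\varphi$ is $\mathcal{D}$-pullback asymptotically compact in $X$. Then $\varphi$ has a unique $\mathcal{D}$-pullback attractor $\mathcal{A}_X=\{\mathcal{A}_X(\tau,\omega);\tau\in\mathbb{R},\omega\in\Omega\}\in\mathcal{D}$ in $X$, given by $$\mathcal{A}_X(\tau,\omega)=\bigcap_{s>0}\overline{\bigcup_{t\ge s}\varphi(t,\tau-t,\vartheta_{-t}\omega,K(\tau-t,\vartheta_{-t}\omega))}^{X},\qquad \tau\in\mathbb{R},\ \omega\in\Omega,$$ where the closure is taken in $X$. If, in addition, the following hold: (a) for every $t>0$, $\tau\in\mathbb{R}$, $\omega\in\Omega$, the map $\varphi(t,\tau,\omega,\cdot)$ sends $X$ into $X\cap Y$; (b) if $\{x_n\}_n\subset X\cap Y$ satisfies $x_n\to x$ in $X$ and $x_n\to y$ in $Y$, then $x=y$; (iii) $\varphi$ is $\mathcal{D}$-pullback asymptotically compact in $Y$; then $\varphi$ has a unique $\mathcal{D}$-pullback attractor $\mathcal{A}_Y=\{\mathcal{A}_Y(\tau,\omega);\tau\in\mathbb{R},\omega\in\Omega\}$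 in $Y$, given by $$\mathcal{A}_Y(\tau,\omega)=\bigcap_{s>0}\overline{\bigcup_{t\ge s}\varphi(t,\tau-t,\vartheta_{-t}\omega,K(\tau-t,\vartheta_{-t}\omega))}^{Y},\qquad \tau\in\mathbb{R},\ \omega\in\Omega,$$ where the closure is taken in $Y$. Moreover $\mathcal{A}_Y=\mathcal{A}_X\subset X\cap Y$ in the sense of sets, i.e. $\mathcal{A}_Y(\tau,\omega)=\mathcal{A}_X(\tau,\omega)$ for every $\tau\in\mathbb{R}$, $\omega\in\Omega$.
   Context: $(X,\|\cdot\|_X)$ and $(Y,\|\cdot\|_Y)$ are complete separable Banach spaces (with $X\cap Y\neq\emptyset$), with Borel $\sigma$-algebras $\mathcal{B}(X),\mathcal{B}(Y)$. No inclusion between $X$ and $Y$ is assumed, and no continuity of $\varphi$ in $Y$. $\mathbb{R}^+=[0,\infty)$. $(\Omega,\mathcal{F},P,\{\vartheta_t\}_{t\in\mathbb{R}})$ is a measurable dynamical system: a probability space with a (jointly measurable) group $\vartheta_t$ of measure preserving transformations. Cocycle: a family of measurable mappings $\varphi:\mathbb{R}^+\times\mathbb{R}\times\Omega\times X\to X$ (i.e. $\varphi(\cdot,\tau,\cdot,\cdot)$ is $(\mathcal{B}(\mathbb{R}^+)\times\mathcal{F}\times\mathcal{B}(X),\mathcal{B}(X))$-measurable for each $\tau$) such that for all $\tau\in\mathbb{R}$, $\omega\in\Omega$, $t,s\in\mathbb{R}^+$: $\varphi(0,\tau,\omega,\cdot)$ is the identity on $X$, and $\varphi(t+s,\tau,\omega,\cdot)=\varphi(t,\tau+s,\vartheta_s\omega,\cdot)\circ\varphi(s,\tau,\omega,\cdot)$.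 It is continuous if $\varphi(t,\tau,\omega,\cdot):X\to X$ is continuous for all $t,\tau,\omega$. $\mathcal{D}$ is a collection of families $B=\{B(\tau,\omega);\tau\in\mathbb{R},\omega\in\Omega\}$ of nonempty subsets of $X$. It is inclusion closed if, whenever $B\in\mathcal{D}$ and $B'$ is a family with $\emptyset\ne B'(\tau,\omega)\subset B(\tau,\omega)$ for all $\tau,\omega$, then $B'\in\mathcal{D}$. $\mathrm{dist}_X(A,B)=\sup_{a\in A}\inf_{b\in B}\|a-b\|_X$ is the Hausdorff semi-metric (similarly $\mathrm{dist}_Y$). A family $K$ is measurable in $X$ (w.r.t. a $\sigma$-algebra $\mathcal{G}$ on $\Omega$) if $\omega\mapsto\mathrm{dist}_X(x,K(\tau,\omega))$ is $\mathcal{G}$-measurable for every $x\in X$, $\tau\in\mathbb{R}$; it is closed if each $K(\tau,\omega)$ is a closed nonempty subset of $X$. $K\in\mathcal{D}$ is a $\mathcal{D}$-pullback absorbing set for $\varphi$ in $X$ if for all $\tau,\omega$ and every $B\in\mathcal{D}$ there is $T=T(\tau,\omega,B)>0$ with $\varphi(t,\tau-t,\vartheta_{-t}\omega,B(\tau-t,\vartheta_{-t}\omega))\subseteq K(\tau,\omega)$ for all $t\ge T$. $\varphi$ is $\mathcal{D}$-pullback asymptotically compact in $X$ (resp. $Y$) if for all $\tau,\omega$ the sequence $\{\varphi(t_n,\tau-t_n,\vartheta_{-t_n}\omega,x_n)\}$ has a convergent subsequence in $X$ (resp. $Y$) whenever $t_n\to\infty$ and $x_n\in B(\tau-t_n,\vartheta_{-t_n}\omega)$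 with $B\in\mathcal{D}$. $\mathcal{A}=\{\mathcal{A}(\tau,\omega)\}\in\mathcal{D}$ is a $\mathcal{D}$-pullback attractor for $\varphi$ in $X$ (resp. in $Y$) if (1) $\mathcal{A}$ is measurable in $X$ w.r.t. the $P$-completion of $\mathcal{F}$ and $\mathcal{A}(\tau,\omega)$ is compact in $X$ (resp. in $Y$) for all $\tau,\omega$; (2) $\varphi(t,\tau,\omega,\mathcal{A}(\tau,\omega))=\mathcal{A}(\tau+t,\vartheta_t\omega)$ for all $t\ge0$, $\tau,\omega$; (3) for every $B\in\mathcal{D}$ and all $\tau,\omega$, $\lim_{t\to\infty}\mathrm{dist}_X(\varphi(t,\tau-t,\vartheta_{-t}\omega,B(\tau-t,\vartheta_{-t}\omega)),\mathcal{A}(\tau,\omega))=0$ (resp. with $\mathrm{dist}_Y$). *)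

theory Defs
  imports "HOL-Probability.Probability"
begin

locale measurable_dynamical_system = prob_space M
  for M :: "'w measure" +
  fixes \<theta> :: "real \<Rightarrow> 'w \<Rightarrow> 'w"
  assumes shift_measurable: "(\<lambda>(t, \<omega>). \<theta> t \<omega>) \<in> borel \<Otimes>\<^sub>M M \<rightarrow>\<^sub>M M"
    and shift_zero: "\<And>\<omega>. \<omega> \<in> space M \<Longrightarrow> \<theta> 0 \<omega> = \<omega>"
    and shift_add: "\<And>t s \<omega>. \<omega> \<in> space M \<Longrightarrow> \<theta> (t + s) \<omega> = \<theta> t (\<theta> s \<omega>)"
    and shift_preserving: "\<And>t. distr M M (\<theta> t) = M"

text \<open>The arguments of \<open>\<phi>\<close> are elapsed time \<open>t\<close>, initial time \<open>\<tau>\<close>, sample point and state.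
  The values of \<open>\<phi>\<close> at negative \<open>t\<close>, and off \<open>space M\<close>, are irrelevant throughout.\<close>

locale cocycle = measurable_dynamical_system M \<theta>
  for M :: "'w measure" and \<theta> :: "real \<Rightarrow> 'w \<Rightarrow> 'w" +
  fixes \<phi> :: "real \<Rightarrow> real \<Rightarrow> 'w \<Rightarrow> 'x \<Rightarrow> 'x::{banach, second_countable_topology}"
  assumes cocycle_measurable:
      "\<And>\<tau>. (\<lambda>(t, \<omega>, x). \<phi> t \<tau> \<omega> x)
         \<in> restrict_space borel {0..} \<Otimes>\<^sub>M M \<Otimes>\<^sub>M borel \<rightarrow>\<^sub>M borel"
    and cocycle_zero: "\<And>\<tau> \<omega>. \<omega> \<in> space M \<Longrightarrow> \<phi> 0 \<tau> \<omega> = id"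
    and cocycle_add: "\<And>t s \<tau> \<omega>. \<lbrakk>0 \<le> t; 0 \<le> s; \<omega> \<in> space M\<rbrakk>
         \<Longrightarrow> \<phi> (t + s) \<tau> \<omega> = \<phi> t (\<tau> + s) (\<theta> s \<omega>) \<circ> \<phi> s \<tau> \<omega>"

locale continuous_cocycle = cocycle M \<theta> \<phi>
  for M :: "'w measure" and \<theta> :: "real \<Rightarrow> 'w \<Rightarrow> 'w"
    and \<phi> :: "real \<Rightarrow> real \<Rightarrow> 'w \<Rightarrow> 'x \<Rightarrow> 'x::{banach, second_countable_topology}" +
  assumes cocycle_continuous:
    "\<And>t \<tau> \<omega>. \<lbrakk>0 \<le> t; \<omega> \<in> space M\<rbrakk> \<Longrightarrow> continuous_on UNIV (\<phi> t \<tau> \<omega>)"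

type_synonym ('w, 'x) family = "real \<Rightarrow> 'w \<Rightarrow> 'x set"

text \<open>Families are indexed by \<open>\<omega> \<in> space M\<close>; two families agreeing there represent the same object.
  Every \<open>inclusion_closed\<close> collection of nonempty families respects this identification.\<close>

definition nonempty_families :: "'w measure \<Rightarrow> ('w, 'x) family set \<Rightarrow> bool" where
  "nonempty_families M \<D> \<longleftrightarrow> (\<forall>B\<in>\<D>. \<forall>\<tau>. \<forall>\<omega>\<in>space M. B \<tau> \<omega> \<noteq> {})"

definition inclusion_closed :: "'w measure \<Rightarrow> ('w, 'x) family set \<Rightarrow> bool" where
  "inclusion_closed M \<D> \<longleftrightarrow>
     (\<forall>B\<in>\<D>. \<forall>B'. (\<forall>\<tau>. \<forall>\<omega>\<in>space M. B' \<tau> \<omega> \<noteq> {} \<and> B' \<tau> \<omega> \<subseteq> B \<tau> \<omega>) \<longrightarrow> B' \<in> \<D>)"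

text \<open>Valued in \<^typ>\<open>ennreal\<close>, as the supremum may be infinite.\<close>

definition hausdorff_semidist :: "'a::real_normed_vector set \<Rightarrow> 'a set \<Rightarrow> ennreal" where
  "hausdorff_semidist A B = (SUP a\<in>A. INF b\<in>B. ennreal (norm (a - b)))"

text \<open>\<open>measurable_family\<close> is only used for families of nonempty sets, where \<^const>\<open>infdist\<close> is the
  infimum of the distances.\<close>

definition measurable_family :: "'w measure \<Rightarrow> ('w, 'x::real_normed_vector) family \<Rightarrow> bool" where
  "measurable_family G K \<longleftrightarrow> (\<forall>x \<tau>. (\<lambda>\<omega>. infdist x (K \<tau> \<omega>)) \<in> borel_measurable G)"

definition closed_family :: "'w measure \<Rightarrow> ('w, 'x::topological_space) family \<Rightarrow> bool" where
  "closed_family M K \<longleftrightarrow> (\<forall>\<tau>. \<forall>\<omega>\<in>space M. closed (K \<tau> \<omega>) \<and> K \<tau> \<omega> \<noteq> {})"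

definition pullback_image ::
  "(real \<Rightarrow> 'w \<Rightarrow> 'w) \<Rightarrow> (real \<Rightarrow> real \<Rightarrow> 'w \<Rightarrow> 'x \<Rightarrow> 'x) \<Rightarrow> ('w, 'x) family
     \<Rightarrow> real \<Rightarrow> real \<Rightarrow> 'w \<Rightarrow> 'x set" where
  "pullback_image \<theta> \<phi> B t \<tau> \<omega> = \<phi> t (\<tau> - t) (\<theta> (- t) \<omega>) ` B (\<tau> - t) (\<theta> (- t) \<omega>)"

definition pullback_absorbing ::
  "'w measure \<Rightarrow> (real \<Rightarrow> 'w \<Rightarrow> 'w) \<Rightarrow> (real \<Rightarrow> real \<Rightarrow> 'w \<Rightarrow> 'x \<Rightarrow> 'x)
     \<Rightarrow> ('w, 'x) family set \<Rightarrow> ('w, 'x) family \<Rightarrow> bool" where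
  "pullback_absorbing M \<theta> \<phi> \<D> K \<longleftrightarrow>
     K \<in> \<D> \<and>
     (\<forall>\<tau>. \<forall>\<omega>\<in>space M. \<forall>B\<in>\<D>. \<exists>T>0. \<forall>t\<ge>T. pullback_image \<theta> \<phi> B t \<tau> \<omega> \<subseteq> K \<tau> \<omega>)"

definition pullback_asymptotically_compact ::
  "'w measure \<Rightarrow> (real \<Rightarrow> 'w \<Rightarrow> 'w) \<Rightarrow> (real \<Rightarrow> real \<Rightarrow> 'w \<Rightarrow> 'x \<Rightarrow> 'x::topological_space)
     \<Rightarrow> ('w, 'x) family set \<Rightarrow> bool" where
  "pullback_asymptotically_compact M \<theta> \<phi> \<D> \<longleftrightarrow>
     (\<forall>\<tau>. \<forall>\<omega>\<in>space M. \<forall>B\<in>\<D>. \<forall>(t :: nat \<Rightarrow> real) x.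
        (\<forall>n. 0 \<le> t n) \<and> filterlim t at_top sequentially \<and>
        (\<forall>n. x n \<in> B (\<tau> - t n) (\<theta> (- t n) \<omega>)) \<longrightarrow>
        (\<exists>r l. strict_mono (r :: nat \<Rightarrow> nat) \<and>
           (\<lambda>n. \<phi> (t (r n)) (\<tau> - t (r n)) (\<theta> (- t (r n)) \<omega>) (x (r n))) \<longlonglongrightarrow> l))"

definition pullback_attractor ::
  "'w measure \<Rightarrow> (real \<Rightarrow> 'w \<Rightarrow> 'w) \<Rightarrow> (real \<Rightarrow> real \<Rightarrow> 'w \<Rightarrow> 'x \<Rightarrow> 'x::real_normed_vector)
     \<Rightarrow> ('w, 'x) family set \<Rightarrow> ('w, 'x) family \<Rightarrow> bool" where
  "pullback_attractor M \<theta> \<phi> \<D> A \<longleftrightarrow>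
     A \<in> \<D> \<and>
     measurable_family (completion M) A \<and>
     (\<forall>\<tau>. \<forall>\<omega>\<in>space M. compact (A \<tau> \<omega>)) \<and>
     (\<forall>t\<ge>0. \<forall>\<tau>. \<forall>\<omega>\<in>space M. \<phi> t \<tau> \<omega> ` A \<tau> \<omega> = A (\<tau> + t) (\<theta> t \<omega>)) \<and>
     (\<forall>B\<in>\<D>. \<forall>\<tau>. \<forall>\<omega>\<in>space M.
        ((\<lambda>t. hausdorff_semidist (pullback_image \<theta> \<phi> B t \<tau> \<omega>) (A \<tau> \<omega>)) \<longlongrightarrow> 0) at_top)"

text \<open>Two Banach spaces that merely overlap as sets are represented by types \<open>'x\<close>, \<open>'y\<close> with
  injections \<open>jX\<close>, \<open>jY\<close> into a common type: the set-theoretic intersection of the spaces is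
  \<open>range jX \<inter> range jY\<close>. No algebraic or topological structure on the common type is used.
  \<open>trace_in jX jY A\<close> is the part of \<open>A \<subseteq> X\<close> lying in \<open>Y\<close>, viewed as a subset of \<open>Y\<close>.\<close>

definition trace_in :: "('x \<Rightarrow> 'e) \<Rightarrow> ('y \<Rightarrow> 'e) \<Rightarrow> 'x set \<Rightarrow> 'y set" where
  "trace_in jX jY A = jY -` (jX ` A)"

text \<open>\<open>jX\<close>, \<open>jY\<close> turn the two notions above into the corresponding ones \<^emph>\<open>in\<close> \<open>Y\<close>, for a
  cocycle and families that live in \<open>X\<close>. Convergence of a sequence in \<open>Y\<close>, compactness
  in \<open>Y\<close> and the semi-distance of \<open>Y\<close> all presuppose that the points involved belong to \<open>Y\<close>;
  these side conditions are stated explicitly.\<close>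

definition pullback_asymptotically_compact_in ::
  "('x \<Rightarrow> 'e) \<Rightarrow> ('y::topological_space \<Rightarrow> 'e) \<Rightarrow> 'w measure \<Rightarrow> (real \<Rightarrow> 'w \<Rightarrow> 'w)
     \<Rightarrow> (real \<Rightarrow> real \<Rightarrow> 'w \<Rightarrow> 'x \<Rightarrow> 'x) \<Rightarrow> ('w, 'x) family set \<Rightarrow> bool" where
  "pullback_asymptotically_compact_in jX jY M \<theta> \<phi> \<D> \<longleftrightarrow>
     (\<forall>\<tau>. \<forall>\<omega>\<in>space M. \<forall>B\<in>\<D>. \<forall>(t :: nat \<Rightarrow> real) x.
        (\<forall>n. 0 \<le> t n) \<and> filterlim t at_top sequentially \<and>
        (\<forall>n. x n \<in> B (\<tau> - t n) (\<theta> (- t n) \<omega>)) \<longrightarrow>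
        (\<exists>r y l. strict_mono (r :: nat \<Rightarrow> nat) \<and>
           (\<forall>n. jX (\<phi> (t (r n)) (\<tau> - t (r n)) (\<theta> (- t (r n)) \<omega>) (x (r n))) = jY (y n)) \<and>
           y \<longlonglongrightarrow> l))"

definition pullback_attractor_in ::
  "('x \<Rightarrow> 'e) \<Rightarrow> ('y::real_normed_vector \<Rightarrow> 'e) \<Rightarrow> 'w measure \<Rightarrow> (real \<Rightarrow> 'w \<Rightarrow> 'w)
     \<Rightarrow> (real \<Rightarrow> real \<Rightarrow> 'w \<Rightarrow> 'x \<Rightarrow> 'x::real_normed_vector)
     \<Rightarrow> ('w, 'x) family set \<Rightarrow> ('w, 'x) family \<Rightarrow> bool" where
  "pullback_attractor_in jX jY M \<theta> \<phi> \<D> A \<longleftrightarrow>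
     A \<in> \<D> \<and>
     measurable_family (completion M) A \<and>
     (\<forall>\<tau>. \<forall>\<omega>\<in>space M. jX ` A \<tau> \<omega> \<subseteq> range jY \<and> compact (trace_in jX jY (A \<tau> \<omega>))) \<and>
     (\<forall>t\<ge>0. \<forall>\<tau>. \<forall>\<omega>\<in>space M. \<phi> t \<tau> \<omega> ` A \<tau> \<omega> = A (\<tau> + t) (\<theta> t \<omega>)) \<and>
     (\<forall>B\<in>\<D>. \<forall>\<tau>. \<forall>\<omega>\<in>space M.
        (\<forall>\<^sub>F t in at_top. jX ` pullback_image \<theta> \<phi> B t \<tau> \<omega> \<subseteq> range jY) \<and>
        ((\<lambda>t. hausdorff_semidist (trace_in jX jY (pullback_image \<theta> \<phi> B t \<tau> \<omega>))
                (trace_in jX jY (A \<tau> \<omega>))) \<longlongrightarrow> 0) at_top)"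

end

theory Submission imports Defs begin

text \<open>The attractor is the pullback omega-limit set \<open>A\<close> of \<open>K\<close>. By asymptotic compactness it is
  nonempty, compact, attracting and invariant, and \<open>A \<subseteq> K\<close> since \<open>K\<close> absorbs itself. Invariance then
  puts \<open>A\<close> inside every pullback image of \<open>K\<close>, so that the distance to \<open>A\<close> is the limit, along
  integer times, of the distances to these images; this gives measurability. For \<open>Y\<close>, extract a
  subsequence converging in both spaces: its limits agree, so the omega-limit sets taken in \<open>X\<close>
  and in \<open>Y\<close> coincide and \<open>A\<close> also attracts in \<open>Y\<close>. The statement for \<open>X\<close> alone is the
  case \<open>Y = X\<close>. An invariant member of \<open>\<D>\<close> is its own pullback image, so two attractors
  attract, and hence contain, each other.\<close>

section \<open>Omega-limit sets of time-indexed sets\<close>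

text \<open>Kept free of cocycles so that it serves twice: for the pullback images in
  \<open>X\<close> and for their traces in \<open>Y\<close>.\<close>

definition omega_limit :: "(real \<Rightarrow> 'a::topological_space set) \<Rightarrow> 'a set" where
  "omega_limit S = (\<Inter>s\<in>{0<..}. closure (\<Union>t\<in>{s..}. S t))"

lemma omega_limitI:
  assumes t: "filterlim t at_top sequentially" and z: "\<And>n. z n \<in> S (t n)" and lim: "z \<longlonglongrightarrow> l"
  shows "l \<in> omega_limit S"
  unfolding omega_limit_def
proof
  fix s :: real assume "s \<in> {0<..}"
  have "\<forall>\<^sub>F n in sequentially. s \<le> t n"
    using t by (simp add: filterlim_at_top)
  then have "\<forall>\<^sub>F n in sequentially. z n \<in> closure (\<Union>t\<in>{s..}. S t)"
  proof eventually_elim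
    case (elim n)
    then have "z n \<in> (\<Union>t\<in>{s..}. S t)" using z[of n] by auto
    then show ?case by (rule subsetD[OF closure_subset])
  qed
  then show "l \<in> closure (\<Union>t\<in>{s..}. S t)"
    by (rule Lim_in_closed_set[OF closed_closure _ _ lim]) simp
qed

lemma omega_limit_approx:
  fixes S :: "real \<Rightarrow> 'a::metric_space set"
  assumes "l \<in> omega_limit S" "0 < e"
  obtains t z where "s \<le> t" "0 \<le> t" "z \<in> S t" "dist z l < e"
proof -
  \<comment> \<open>The intersection ranges over positive indices only; \<open>max s 1\<close> is
    such an index and yields both lower bounds on the time.\<close>
  have "l \<in> closure (\<Union>t\<in>{max s 1..}. S t)"
    using assms(1) by (auto simp: omega_limit_def)
  then obtain z where "z \<in> (\<Union>t\<in>{max s 1..}. S t)" "dist z l < e"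
    using \<open>0 < e\<close> closure_approachable by blast
  then show ?thesis using that by auto
qed

text \<open>Converse to \<open>omega_limitI\<close>: for each \<open>n\<close>, choose a point
  within \<open>1/(n+1)\<close> of \<open>l\<close> at a time at least \<open>n\<close>.\<close>

lemma omega_limitD:
  fixes S :: "real \<Rightarrow> 'a::metric_space set"
  assumes "l \<in> omega_limit S"
  shows "\<exists>(t :: nat \<Rightarrow> real) z. (\<forall>n. 0 \<le> t n) \<and> filterlim t at_top sequentially \<and>
    (\<forall>n. z n \<in> S (t n)) \<and> z \<longlonglongrightarrow> l"
proof -
  have "\<exists>t z. real n \<le> t \<and> 0 \<le> t \<and> z \<in> S t \<and> dist z l < inverse (real (Suc n))" for n
  proof -
    have "0 < inverse (real (Suc n))" by simp
    then show ?thesis by (rule omega_limit_approx[OF assms, of _ "real n"]) blast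
  qed
  then obtain t z where tz: "\<And>n. real n \<le> t n" "\<And>n. 0 \<le> t n" "\<And>n. z n \<in> S (t n)"
      "\<And>n. dist (z n) l < inverse (real (Suc n))"
    by metis
  have "filterlim t at_top sequentially"
    by (rule filterlim_at_top_mono[OF filterlim_real_sequentially]) (simp add: tz)
  moreover have "(\<lambda>n. dist (z n) l) \<longlonglongrightarrow> 0"
    by (rule tendsto_sandwich[OF _ _ tendsto_const LIMSEQ_inverse_real_of_nat])
       (use tz in \<open>auto intro!: always_eventually less_imp_le simp del: of_nat_Suc\<close>)
  then have "z \<longlonglongrightarrow> l" by (simp add: tendsto_dist_iff[symmetric])
  ultimately show ?thesis using tz by blast
qed

text \<open>Approximate a sequence of omega-limit points term by term by points of \<open>S\<close>
  at times at least \<open>n\<close>, with error tending to 0. The approximants have a convergent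
  subsequence by hypothesis, its limit is again an omega-limit point, and the original sequence
  follows along the same indices.\<close>

lemma compact_omega_limit:
  fixes S :: "real \<Rightarrow> 'a::metric_space set"
  assumes ac: "\<And>t z. (\<And>n. 0 \<le> t n) \<Longrightarrow> filterlim t at_top sequentially \<Longrightarrow> (\<And>n. z n \<in> S (t n)) \<Longrightarrow>
      \<exists>r l. strict_mono (r :: nat \<Rightarrow> nat) \<and> (z \<circ> r) \<longlonglongrightarrow> l"
  shows "compact (omega_limit S)"
  unfolding compact_eq_seq_compact_metric seq_compact_def
proof (intro allI impI)
  fix y :: "nat \<Rightarrow> 'a" assume y: "\<forall>n. y n \<in> omega_limit S"
  have "\<exists>t z. real n \<le> t \<and> 0 \<le> t \<and> z \<in> S t \<and> dist z (y n) < inverse (real (Suc n))" for n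
  proof -
    have "y n \<in> omega_limit S" "0 < inverse (real (Suc n))" using y by auto
    then show ?thesis by (rule omega_limit_approx[of _ _ _ "real n"]) blast
  qed
  then obtain t z where tz: "\<And>n. real n \<le> t n" "\<And>n. 0 \<le> t n" "\<And>n. z n \<in> S (t n)"
      "\<And>n. dist (z n) (y n) < inverse (real (Suc n))"
    by metis
  have t: "filterlim t at_top sequentially"
    by (rule filterlim_at_top_mono[OF filterlim_real_sequentially]) (simp add: tz)
  obtain r l where r: "strict_mono r" and l: "(z \<circ> r) \<longlonglongrightarrow> l"
    using ac[OF tz(2) t tz(3)] by blast
  have "filterlim (t \<circ> r) at_top sequentially"
    using filterlim_compose[OF t filterlim_subseq[OF r]] by (simp add: o_def)
  then have "l \<in> omega_limit S"
    by (rule omega_limitI[OF _ _ l]) (simp add: tz)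
  have "(\<lambda>n. dist (z n) (y n)) \<longlonglongrightarrow> 0"
    by (rule tendsto_sandwich[OF _ _ tendsto_const LIMSEQ_inverse_real_of_nat])
       (use tz in \<open>auto intro!: always_eventually less_imp_le simp del: of_nat_Suc\<close>)
  then have "(\<lambda>n. dist (z (r n)) (y (r n))) \<longlonglongrightarrow> 0"
    using LIMSEQ_subseq_LIMSEQ[OF _ r, of "\<lambda>n. dist (z n) (y n)" 0] by (simp add: o_def)
  moreover have "(\<lambda>n. dist (z (r n)) l) \<longlonglongrightarrow> 0"
    using l by (simp add: o_def tendsto_dist_iff[symmetric])
  ultimately have lim0: "(\<lambda>n. dist (z (r n)) (y (r n)) + dist (z (r n)) l) \<longlonglongrightarrow> 0"
    by (rule tendsto_add_zero)
  have "(\<lambda>n. dist ((y \<circ> r) n) l) \<longlonglongrightarrow> 0"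
    by (rule tendsto_sandwich[OF _ _ tendsto_const lim0])
       (auto intro!: always_eventually dist_triangle3)
  then have "(y \<circ> r) \<longlonglongrightarrow> l" by (rule tendsto_dist_iff[THEN iffD2])
  with \<open>l \<in> omega_limit S\<close> show "\<exists>l\<in>omega_limit S. \<exists>r. strict_mono r \<and> (y \<circ> r) \<longlonglongrightarrow> l"
    using r by blast
qed

text \<open>Otherwise there are times tending to infinity at which \<open>S\<close> has points
  bounded away from \<open>C\<close>, while a subsequence of these points converges to a point of
  \<open>C\<close>.\<close>

lemma hausdorff_semidist_tendsto_0:
  fixes S :: "real \<Rightarrow> 'a::real_normed_vector set"
  assumes "\<And>t z. (\<And>n. 0 \<le> t n) \<Longrightarrow> filterlim t at_top sequentially \<Longrightarrow> (\<And>n. z n \<in> S (t n)) \<Longrightarrow>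
      \<exists>r l. strict_mono (r :: nat \<Rightarrow> nat) \<and> (z \<circ> r) \<longlonglongrightarrow> l \<and> l \<in> C"
  shows "((\<lambda>t. hausdorff_semidist (S t) C) \<longlongrightarrow> 0) at_top"
proof (rule order_tendstoI)
  fix a :: ennreal assume "0 < a"
  \<comment> \<open>The supremum need not be attained; the gap \<open>e < a\<close> provides a point
    at distance more than \<open>e\<close> whenever the semi-distance is at least
    \<open>a\<close>.\<close>
  then obtain e where e: "0 < e" "e < a" using dense by blast
  show "\<forall>\<^sub>F t in at_top. hausdorff_semidist (S t) C < a"
  proof (rule ccontr)
    assume "\<not> ?thesis"
    then have "\<forall>n. \<exists>t\<ge>real n. a \<le> hausdorff_semidist (S t) C"
      by (auto simp: eventually_at_top_linorder not_less)
    then obtain t where t: "\<And>n. real n \<le> t n" "\<And>n. a \<le> hausdorff_semidist (S (t n)) C"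
      by metis
    have "\<exists>z\<in>S (t n). e < (INF b\<in>C. ennreal (norm (z - b)))" for n
      using less_le_trans[OF e(2) t(2)[of n]] by (simp add: hausdorff_semidist_def less_SUP_iff)
    then obtain z where z: "\<And>n. z n \<in> S (t n)" "\<And>n. e < (INF b\<in>C. ennreal (norm (z n - b)))"
      by metis
    have "filterlim t at_top sequentially"
      by (rule filterlim_at_top_mono[OF filterlim_real_sequentially]) (simp add: t)
    moreover have "0 \<le> t n" for n using t(1)[of n] by linarith
    ultimately obtain r l where l: "(z \<circ> r) \<longlonglongrightarrow> l" "l \<in> C"
      using assms z(1) by meson
    have "(\<lambda>n. norm (z (r n) - l)) \<longlonglongrightarrow> 0"
      using l(1) by (simp add: o_def LIM_zero_iff tendsto_norm_zero_iff)
    then have "(\<lambda>n. ennreal (norm (z (r n) - l))) \<longlonglongrightarrow> 0"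
      using tendsto_ennrealI by fastforce
    moreover have "e \<le> ennreal (norm (z (r n) - l))" for n
      using z(2)[of "r n"] INF_lower[OF l(2), of "\<lambda>b. ennreal (norm (z (r n) - b))"]
      by (meson less_imp_le less_le_trans)
    ultimately have "e \<le> 0"
      by (intro LIMSEQ_le_const) auto
    then show False using e by simp
  qed
qed simp

lemma hausdorff_semidist_0_imp_subset:
  assumes "hausdorff_semidist A B = 0" "closed B"
  shows "A \<subseteq> B"
proof
  fix a assume "a \<in> A"
  have "\<exists>b\<in>B. dist b a < e" if "0 < e" for e
  proof -
    have "(INF b\<in>B. ennreal (norm (a - b))) \<le> hausdorff_semidist A B"
      unfolding hausdorff_semidist_def using \<open>a \<in> A\<close> by (rule SUP_upper)
    also have "\<dots> < ennreal e" using assms that by simp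
    finally obtain b where "b \<in> B" "ennreal (norm (a - b)) < ennreal e"
      by (auto simp: INF_less_iff)
    then show ?thesis
      by (auto simp: dist_norm norm_minus_commute ennreal_less_iff)
  qed
  then show "a \<in> B" using assms(2) closed_approachable by blast
qed

section \<open>Measurability\<close>

lemma infdist_less_iff:
  assumes "A \<noteq> {}" shows "infdist x A < c \<longleftrightarrow> (\<exists>a\<in>A. dist x a < c)"
  using assms by (simp add: infdist_notempty cINF_less_iff bdd_belowI2[of _ 0])

text \<open>A point of \<open>K \<omega>\<close> in the open set \<open>{k. g \<omega> k < c}\<close> can be detected with
  countably many balls: some ball meets \<open>K \<omega>\<close>, and on a countable dense subset of that ball
  \<open>g \<omega>\<close> stays below a rational number smaller than \<open>c\<close>. This avoids measurable selections.\<close>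

lemma sets_random_set_hits_sublevel:
  fixes K :: "'w \<Rightarrow> 'x::{metric_space, second_countable_topology} set" and g :: "'w \<Rightarrow> 'x \<Rightarrow> real"
  assumes K[measurable]: "\<And>q. (\<lambda>\<omega>. infdist q (K \<omega>)) \<in> borel_measurable N"
    and ne: "\<And>\<omega>. \<omega> \<in> space N \<Longrightarrow> K \<omega> \<noteq> {}"
    and g[measurable]: "\<And>k. (\<lambda>\<omega>. g \<omega> k) \<in> borel_measurable N"
    and cont: "\<And>\<omega>. \<omega> \<in> space N \<Longrightarrow> continuous_on UNIV (g \<omega>)"
  shows "{\<omega> \<in> space N. \<exists>k\<in>K \<omega>. g \<omega> k < c} \<in> sets N"
proof -
  obtain D :: "'x set" where D: "topological_basis (case_prod ball ` (D \<times> (\<rat> \<inter> {0<..})))" "countable D"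
    using balls_countable_basis by blast
  obtain E :: "'x set" where E: "countable E" "\<And>U. open U \<Longrightarrow> U \<noteq> {} \<Longrightarrow> \<exists>y\<in>E. y \<in> U"
    using countable_dense_exists by blast
  define I where "I = (D \<times> (\<rat> \<inter> {0::real<..})) \<times> (\<rat> \<inter> {..<c})"
  have "countable I"
    unfolding I_def by (intro countable_SIGMA D(2) countable_Int1 countable_rat)
  define H where "H = (\<lambda>((q, r), c'). {\<omega> \<in> space N. infdist q (K \<omega>) < r} \<inter>
      {\<omega> \<in> space N. \<forall>d\<in>E \<inter> ball q r. g \<omega> d \<le> c'})"
  have "H i \<in> sets N" for i
  proof -
    obtain q r c' where i: "i = ((q, r), c')" by (metis prod.exhaust)
    have [measurable]: "countable (E \<inter> ball q r)" using E(1) by auto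
    have "{\<omega> \<in> space N. \<forall>d\<in>E \<inter> ball q r. g \<omega> d \<le> c'} \<in> sets N" by measurable
    moreover have "{\<omega> \<in> space N. infdist q (K \<omega>) < r} \<in> sets N" by measurable
    ultimately show ?thesis by (simp add: H_def i)
  qed
  then have "(\<Union>i\<in>I. H i) \<in> sets N"
    using \<open>countable I\<close> by blast
  also have "(\<Union>i\<in>I. H i) = {\<omega> \<in> space N. \<exists>k\<in>K \<omega>. g \<omega> k < c}" (is "?L = ?R")
  proof
    show "?L \<subseteq> ?R"
    proof
      fix \<omega> assume "\<omega> \<in> ?L"
      then obtain q r c' where w: "\<omega> \<in> space N" "c' < c" "infdist q (K \<omega>) < r"
          and le: "\<forall>d\<in>E \<inter> ball q r. g \<omega> d \<le> c'"
        by (auto simp: I_def H_def)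
      obtain k where k: "k \<in> K \<omega>" "dist q k < r"
        using w ne[OF w(1)] by (auto simp: infdist_less_iff)
      \<comment> \<open>Continuity extends the bound from the dense points of the ball to all of it:
        if it failed at \<open>k\<close>, it would fail on a neighbourhood and so at a point of
        \<open>E\<close>. Only the weak inequality survives, which is why \<open>c'\<close> is taken
        strictly below \<open>c\<close>.\<close>
      have "g \<omega> k \<le> c'"
      proof (rule ccontr)
        assume "\<not> g \<omega> k \<le> c'"
        moreover have "open (g \<omega> -` {c'<..})"
          using cont[OF w(1)] by (simp add: open_vimage continuous_on_eq_continuous_at)
        ultimately obtain d where "d \<in> E" "d \<in> ball q r \<inter> g \<omega> -` {c'<..}"
          using E(2)[of "ball q r \<inter> g \<omega> -` {c'<..}"] k by fastforce
        moreover from this have "g \<omega> d \<le> c'" using le by blast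
        ultimately show False by simp
      qed
      then show "\<omega> \<in> ?R" using w k by force
    qed
  next
    show "?R \<subseteq> ?L"
    proof
      fix \<omega> assume "\<omega> \<in> ?R"
      then obtain k where w: "\<omega> \<in> space N" and k: "k \<in> K \<omega>" "g \<omega> k < c" by blast
      obtain c' where c': "c' \<in> \<rat>" "g \<omega> k < c'" "c' < c"
        using Rats_dense_in_real[OF k(2)] by blast
      have "open (g \<omega> -` {..<c'})"
        using cont[OF w] by (simp add: open_vimage continuous_on_eq_continuous_at)
      moreover have "k \<in> g \<omega> -` {..<c'}" using c'(2) by simp
      ultimately obtain V where "V \<in> case_prod ball ` (D \<times> (\<rat> \<inter> {0<..}))" "k \<in> V" "V \<subseteq> g \<omega> -` {..<c'}"
        by (rule topological_basisE[OF D(1)])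
      then obtain q r where qr: "q \<in> D" "r \<in> \<rat>" "0 < r" "k \<in> ball q r" "ball q r \<subseteq> g \<omega> -` {..<c'}"
        by auto
      have "infdist q (K \<omega>) < r"
        using infdist_le[OF k(1), of q] qr(4) by simp
      then have "\<omega> \<in> H ((q, r), c')"
        using w qr(5) by (fastforce simp: H_def)
      moreover have "((q, r), c') \<in> I" using qr c' by (simp add: I_def)
      ultimately show "\<omega> \<in> ?L" by blast
    qed
  qed
  finally show ?thesis .
qed

text \<open>The distance to the image is below \<open>c\<close> iff \<open>K \<omega>\<close> has a
  point where \<open>dist x (f \<omega> k) < c\<close>, an event covered by the previous
  lemma.\<close>

lemma borel_measurable_infdist_image:
  fixes K :: "'w \<Rightarrow> 'x::{metric_space, second_countable_topology} set"
    and f :: "'w \<Rightarrow> 'x \<Rightarrow> 'z::{metric_space, second_countable_topology}"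
  assumes K: "\<And>q. (\<lambda>\<omega>. infdist q (K \<omega>)) \<in> borel_measurable N"
    and ne: "\<And>\<omega>. \<omega> \<in> space N \<Longrightarrow> K \<omega> \<noteq> {}"
    and f[measurable]: "\<And>k. (\<lambda>\<omega>. f \<omega> k) \<in> borel_measurable N"
    and cont: "\<And>\<omega>. \<omega> \<in> space N \<Longrightarrow> continuous_on UNIV (f \<omega>)"
  shows "(\<lambda>\<omega>. infdist x (f \<omega> ` K \<omega>)) \<in> borel_measurable N"
  unfolding borel_measurable_iff_less
proof
  fix c
  have "{\<omega> \<in> space N. infdist x (f \<omega> ` K \<omega>) < c} = {\<omega> \<in> space N. \<exists>k\<in>K \<omega>. dist x (f \<omega> k) < c}"
    using ne by (auto simp: infdist_less_iff)
  also have "\<dots> \<in> sets N"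
    by (rule sets_random_set_hits_sublevel[OF K ne])
       (auto intro!: continuous_intros cont)
  finally show "{\<omega> \<in> space N. infdist x (f \<omega> ` K \<omega>) < c} \<in> sets N" .
qed

text \<open>Preservation of the measure makes preimages of null sets null, and this lifts
  measurability to the completions. It is applied to the shifts.\<close>

lemma measurable_completion_completion:
  assumes f: "f \<in> M \<rightarrow>\<^sub>M N" and "distr M N f = N"
  shows "f \<in> completion M \<rightarrow>\<^sub>M completion N"
proof (rule completion.measurable_completion2)
  show f': "f \<in> completion M \<rightarrow>\<^sub>M N" using f by (rule measurable_completion)
  show "null_sets N \<subseteq> null_sets (distr (completion M) N f)"
  proof
    fix A assume "A \<in> null_sets N"
    then have "A \<in> null_sets (distr M N f)" using assms(2) by simp
    then have "f -` A \<inter> space M \<in> null_sets M" "A \<in> sets N"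
      using f by (auto simp: null_sets_distr_iff)
    then show "A \<in> null_sets (distr (completion M) N f)"
      using f' by (auto simp: null_sets_distr_iff null_sets_completionI)
  qed
qed

section \<open>Pullback images\<close>

context cocycle
begin

section \<open>Shifts of the sample space and cutting of pullback runs\<close>

lemma shift_measurable_at: "\<theta> t \<in> M \<rightarrow>\<^sub>M M"
proof -
  have "(\<lambda>\<omega>. (\<lambda>(t, \<omega>). \<theta> t \<omega>) (t, \<omega>)) \<in> M \<rightarrow>\<^sub>M M"
    by (rule measurable_compose[OF _ shift_measurable]) simp
  then show ?thesis by simp
qed

lemma shift_space: "\<omega> \<in> space M \<Longrightarrow> \<theta> t \<omega> \<in> space M"
  using measurable_space[OF shift_measurable_at] .

lemma shift_shift: "\<omega> \<in> space M \<Longrightarrow> \<theta> t (\<theta> s \<omega>) = \<theta> (t + s) \<omega>"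
  by (simp add: shift_add)

lemma cocycle_measurable_at:
  assumes "0 \<le> t" shows "(\<lambda>\<omega>. \<phi> t \<tau> \<omega> x) \<in> borel_measurable M"
proof -
  have "(\<lambda>\<omega>. (t, \<omega>, x)) \<in> M \<rightarrow>\<^sub>M restrict_space borel {0..} \<Otimes>\<^sub>M M \<Otimes>\<^sub>M borel"
    using assms by (intro measurable_Pair measurable_const) (auto simp: space_restrict_space)
  from measurable_compose[OF this cocycle_measurable[of \<tau>]] show ?thesis by simp
qed

text \<open>Both sides run from time \<open>\<tau> - s\<close> and sample point
  \<open>\<theta> (- s) \<omega>\<close> to time \<open>\<tau> + t\<close>; the cocycle law cuts the
  run at time \<open>\<tau>\<close>.\<close>

lemma pullback_image_add:
  assumes "0 \<le> t" "0 \<le> s" "\<omega> \<in> space M"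
  shows "pullback_image \<theta> \<phi> B (t + s) (\<tau> + t) (\<theta> t \<omega>) = \<phi> t \<tau> \<omega> ` pullback_image \<theta> \<phi> B s \<tau> \<omega>"
  using assms cocycle_add[of t s "\<theta> (- s) \<omega>" "\<tau> - s"]
  by (simp add: pullback_image_def shift_shift shift_space shift_zero image_comp)

text \<open>The same cut seen from the end point: the last \<open>s\<close> units of the run are
  separated off.\<close>

lemma pullback_image_split:
  assumes "0 \<le> s" "s \<le> t" "\<omega> \<in> space M"
  shows "pullback_image \<theta> \<phi> B t \<tau> \<omega> =
    \<phi> s (\<tau> - s) (\<theta> (- s) \<omega>) ` pullback_image \<theta> \<phi> B (t - s) (\<tau> - s) (\<theta> (- s) \<omega>)"
  using pullback_image_add[of s "t - s" "\<theta> (- s) \<omega>" B "\<tau> - s"] assms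
  by (simp add: shift_shift shift_space shift_zero)

lemma pullback_image_invariant:
  assumes "\<forall>t\<ge>0. \<forall>\<tau>. \<forall>\<omega>\<in>space M. \<phi> t \<tau> \<omega> ` A \<tau> \<omega> = A (\<tau> + t) (\<theta> t \<omega>)"
    and "0 \<le> t" "\<omega> \<in> space M"
  shows "pullback_image \<theta> \<phi> A t \<tau> \<omega> = A \<tau> \<omega>"
  using assms by (simp add: pullback_image_def shift_shift shift_space shift_zero)

text \<open>The semi-distance from the pullback image of \<open>A'\<close> to \<open>A\<close> in
  \<open>Y\<close> is constant for nonnegative times and tends to 0, so it vanishes; compact sets
  being closed, this gives inclusion of the traces.\<close>

lemma pullback_attractor_in_subset:
  assumes "inj jX" "inj jY"
    and A: "pullback_attractor_in jX jY M \<theta> \<phi> \<D> A" and A': "pullback_attractor_in jX jY M \<theta> \<phi> \<D> A'"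
    and "\<omega> \<in> space M"
  shows "A' \<tau> \<omega> \<subseteq> A \<tau> \<omega>"
proof -
  have inv: "\<forall>t\<ge>0. \<forall>\<tau>. \<forall>\<omega>\<in>space M. \<phi> t \<tau> \<omega> ` A' \<tau> \<omega> = A' (\<tau> + t) (\<theta> t \<omega>)"
    and "A' \<in> \<D>" and sub: "jX ` A' \<tau> \<omega> \<subseteq> range jY"
    using A' \<open>\<omega> \<in> space M\<close> unfolding pullback_attractor_in_def by blast+
  have compact: "compact (trace_in jX jY (A \<tau> \<omega>))"
    using A \<open>\<omega> \<in> space M\<close> unfolding pullback_attractor_in_def by blast
  have "((\<lambda>t. hausdorff_semidist (trace_in jX jY (pullback_image \<theta> \<phi> A' t \<tau> \<omega>))
      (trace_in jX jY (A \<tau> \<omega>))) \<longlongrightarrow> 0) at_top"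
    using A \<open>\<omega> \<in> space M\<close> \<open>A' \<in> \<D>\<close> unfolding pullback_attractor_in_def by blast
  moreover have "\<forall>\<^sub>F t in at_top. hausdorff_semidist (trace_in jX jY (pullback_image \<theta> \<phi> A' t \<tau> \<omega>))
      (trace_in jX jY (A \<tau> \<omega>)) = hausdorff_semidist (trace_in jX jY (A' \<tau> \<omega>)) (trace_in jX jY (A \<tau> \<omega>))"
    using eventually_ge_at_top[of 0]
    by eventually_elim (simp add: pullback_image_invariant[OF inv _ \<open>\<omega> \<in> space M\<close>])
  ultimately have "((\<lambda>t::real. hausdorff_semidist (trace_in jX jY (A' \<tau> \<omega>))
      (trace_in jX jY (A \<tau> \<omega>))) \<longlongrightarrow> 0) at_top"
    by (rule Lim_transform_eventually)
  then have "hausdorff_semidist (trace_in jX jY (A' \<tau> \<omega>)) (trace_in jX jY (A \<tau> \<omega>)) = 0"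
    by (simp add: tendsto_const_iff)
  then have "trace_in jX jY (A' \<tau> \<omega>) \<subseteq> trace_in jX jY (A \<tau> \<omega>)"
    using compact compact_imp_closed hausdorff_semidist_0_imp_subset by blast
  then have sub': "\<And>y. jY y \<in> jX ` A' \<tau> \<omega> \<Longrightarrow> jY y \<in> jX ` A \<tau> \<omega>"
    unfolding trace_in_def vimage_def by (simp add: Collect_mono_iff)
  \<comment> \<open>Inclusion of traces concerns points of \<open>Y\<close> only; it lifts to
    \<open>X\<close> because all of \<open>A'\<close> lies in \<open>Y\<close>.\<close>
  have "jX ` A' \<tau> \<omega> \<subseteq> jX ` A \<tau> \<omega>"
  proof
    fix v assume v: "v \<in> jX ` A' \<tau> \<omega>"
    then obtain y where "v = jY y" using sub by blast
    then show "v \<in> jX ` A \<tau> \<omega>" using sub'[of y] v by simp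
  qed
  then show ?thesis
    using \<open>inj jX\<close> by (simp add: inj_image_subset_iff)
qed

end

section \<open>The notions in \<open>Y\<close> for \<open>Y = X\<close>, and compactness in terms of
  pullback images\<close>

lemma trace_in_id: "trace_in id id A = A"
  by (simp add: trace_in_def)

lemma pullback_attractor_in_id:
  "pullback_attractor_in id id M \<theta> \<phi> \<D> A = pullback_attractor M \<theta> \<phi> \<D> A"
  by (simp add: pullback_attractor_in_def pullback_attractor_def trace_in_id)

lemma pullback_asymptotically_compact_in_id:
  assumes "pullback_asymptotically_compact M \<theta> \<phi> \<D>"
  shows "pullback_asymptotically_compact_in id id M \<theta> \<phi> \<D>"
  unfolding pullback_asymptotically_compact_in_def
proof (intro allI ballI impI)
  fix \<tau> \<omega> B and t :: "nat \<Rightarrow> real" and x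
  assume "\<omega> \<in> space M" "B \<in> \<D>" and
    "(\<forall>n. 0 \<le> t n) \<and> filterlim t at_top sequentially \<and> (\<forall>n. x n \<in> B (\<tau> - t n) (\<theta> (- t n) \<omega>))"
  then obtain r l where "strict_mono (r :: nat \<Rightarrow> nat)"
      "(\<lambda>n. \<phi> (t (r n)) (\<tau> - t (r n)) (\<theta> (- t (r n)) \<omega>) (x (r n))) \<longlonglongrightarrow> l"
    using assms unfolding pullback_asymptotically_compact_def by blast
  then show "\<exists>r y l. strict_mono (r :: nat \<Rightarrow> nat) \<and>
       (\<forall>n. id (\<phi> (t (r n)) (\<tau> - t (r n)) (\<theta> (- t (r n)) \<omega>) (x (r n))) = id (y n)) \<and> y \<longlonglongrightarrow> l"
    by (intro exI conjI allI) (assumption | rule refl)+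
qed

text \<open>The definition starts from initial states, whereas the later arguments select points of
  pullback images; the initial states are recovered by choice.\<close>

lemma pullback_asymptotically_compact_inD:
  assumes "pullback_asymptotically_compact_in jX jY M \<theta> \<phi> \<D>" "\<omega> \<in> space M" "B \<in> \<D>"
    and "\<And>n. 0 \<le> t n" "filterlim t at_top sequentially"
    and "\<And>n. w n \<in> pullback_image \<theta> \<phi> B (t n) \<tau> \<omega>"
  shows "\<exists>r y l. strict_mono (r :: nat \<Rightarrow> nat) \<and> (\<forall>n. jX (w (r n)) = jY (y n)) \<and> y \<longlonglongrightarrow> l"
proof -
  have "\<exists>x. x \<in> B (\<tau> - t n) (\<theta> (- t n) \<omega>) \<and> w n = \<phi> (t n) (\<tau> - t n) (\<theta> (- t n) \<omega>) x" for n
    using assms(6)[of n] by (auto simp: pullback_image_def)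
  then obtain x where x: "\<And>n. x n \<in> B (\<tau> - t n) (\<theta> (- t n) \<omega>)"
      "\<And>n. w n = \<phi> (t n) (\<tau> - t n) (\<theta> (- t n) \<omega>) (x n)"
    by metis
  have "\<exists>r y l. strict_mono (r :: nat \<Rightarrow> nat) \<and>
       (\<forall>n. jX (\<phi> (t (r n)) (\<tau> - t (r n)) (\<theta> (- t (r n)) \<omega>) (x (r n))) = jY (y n)) \<and> y \<longlonglongrightarrow> l"
    using assms(1-5) x(1) unfolding pullback_asymptotically_compact_in_def by blast
  then show ?thesis by (simp add: x(2)[symmetric])
qed

section \<open>The attractor\<close>

locale absorbed_cocycle = continuous_cocycle M \<theta> \<phi>
  for M :: "'w measure" and \<theta> :: "real \<Rightarrow> 'w \<Rightarrow> 'w"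
    and \<phi> :: "real \<Rightarrow> real \<Rightarrow> 'w \<Rightarrow> 'x \<Rightarrow> 'x::{banach, second_countable_topology}" +
  fixes \<D> :: "('w, 'x) family set" and K :: "('w, 'x) family"
  assumes inclusion_closed: "inclusion_closed M \<D>"
    and closed_K: "closed_family M K"
    and measurable_K: "measurable_family (completion M) K"
    and absorbing: "pullback_absorbing M \<theta> \<phi> \<D> K"
    and asymptotically_compact: "pullback_asymptotically_compact M \<theta> \<phi> \<D>"
begin

definition attractor :: "('w, 'x) family" where
  "attractor \<tau> \<omega> = omega_limit (\<lambda>t. pullback_image \<theta> \<phi> K t \<tau> \<omega>)"

section \<open>Absorption and convergence to the omega-limit set\<close>

lemma K_in: "K \<in> \<D>"
  using absorbing by (simp add: pullback_absorbing_def)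

lemma absorbs:
  assumes "B \<in> \<D>" "\<omega> \<in> space M"
  shows "\<forall>\<^sub>F t in at_top. pullback_image \<theta> \<phi> B t \<tau> \<omega> \<subseteq> K \<tau> \<omega>"
proof -
  obtain T where "\<forall>t\<ge>T. pullback_image \<theta> \<phi> B t \<tau> \<omega> \<subseteq> K \<tau> \<omega>"
    using absorbing assms unfolding pullback_absorbing_def by blast
  then show ?thesis by (auto simp: eventually_at_top_linorder)
qed

text \<open>Absorption is applied at the earlier time \<open>\<tau> - s\<close>: a long run has
  entered \<open>K\<close> before its last \<open>s\<close> units, and these carry it into the image
  of \<open>K\<close>.\<close>

lemma eventually_pullback_image_subset:
  assumes "B \<in> \<D>" "\<omega> \<in> space M" "0 \<le> s"
  shows "\<forall>\<^sub>F t in at_top. pullback_image \<theta> \<phi> B t \<tau> \<omega> \<subseteq> pullback_image \<theta> \<phi> K s \<tau> \<omega>"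
proof -
  obtain T where T: "\<And>t. T \<le> t \<Longrightarrow>
      pullback_image \<theta> \<phi> B t (\<tau> - s) (\<theta> (- s) \<omega>) \<subseteq> K (\<tau> - s) (\<theta> (- s) \<omega>)"
    using absorbs[OF assms(1) shift_space[OF assms(2)], of "\<tau> - s" "- s"]
    by (auto simp: eventually_at_top_linorder)
  show ?thesis
    unfolding eventually_at_top_linorder
  \<comment> \<open>The bound \<open>s\<close> permits the cut; the bound \<open>T + s\<close>
    leaves an initial part of length at least \<open>T\<close>.\<close>
  proof (intro exI[of _ "max s (T + s)"] allI impI)
    fix t assume "max s (T + s) \<le> t"
    then have "s \<le> t" "T \<le> t - s" by auto
    then show "pullback_image \<theta> \<phi> B t \<tau> \<omega> \<subseteq> pullback_image \<theta> \<phi> K s \<tau> \<omega>"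
      using T[of "t - s"] pullback_image_split[OF assms(3) \<open>s \<le> t\<close> assms(2)]
      by (simp add: pullback_image_def[of \<theta> \<phi> K] image_mono)
  qed
qed

text \<open>The omega-limit set is built from \<open>K\<close> alone, yet it captures limits arising
  from every \<open>B\<close> in \<open>\<D>\<close>: for each \<open>s\<close>, late images of
  \<open>B\<close> lie in the image of \<open>K\<close> at time \<open>s\<close>, which is one of
  the sets in the union.\<close>

lemma limit_in_attractor:
  assumes B: "B \<in> \<D>" and \<omega>: "\<omega> \<in> space M" and t: "filterlim t at_top sequentially"
    and z: "\<And>n. z n \<in> pullback_image \<theta> \<phi> B (t n) \<tau> \<omega>" and lim: "z \<longlonglongrightarrow> l"
  shows "l \<in> attractor \<tau> \<omega>"
  unfolding attractor_def omega_limit_def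
proof
  fix s :: real assume s: "s \<in> {0<..}"
  then have "\<forall>\<^sub>F n in sequentially. pullback_image \<theta> \<phi> B (t n) \<tau> \<omega> \<subseteq> pullback_image \<theta> \<phi> K s \<tau> \<omega>"
    using filterlim_iff[THEN iffD1, OF t] eventually_pullback_image_subset[OF B \<omega>, of s \<tau>] by auto
  then have "\<forall>\<^sub>F n in sequentially. z n \<in> closure (\<Union>t\<in>{s..}. pullback_image \<theta> \<phi> K t \<tau> \<omega>)"
  proof eventually_elim
    case (elim n)
    then have "z n \<in> (\<Union>t\<in>{s..}. pullback_image \<theta> \<phi> K t \<tau> \<omega>)" using z[of n] by auto
    then show ?case by (rule subsetD[OF closure_subset])
  qed
  then show "l \<in> closure (\<Union>t\<in>{s..}. pullback_image \<theta> \<phi> K t \<tau> \<omega>)"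
    by (rule Lim_in_closed_set[OF closed_closure _ _ lim]) simp
qed

text \<open>Compactness in \<open>X\<close> combined with the previous lemma; it yields
  nonemptiness, the backward half of invariance, measurability and the passage to
  \<open>Y\<close>.\<close>

lemma subsequence_to_attractor:
  assumes B: "B \<in> \<D>" and \<omega>: "\<omega> \<in> space M" and t: "\<And>n. 0 \<le> t n" "filterlim t at_top sequentially"
    and w: "\<And>n. w n \<in> pullback_image \<theta> \<phi> B (t n) \<tau> \<omega>"
  shows "\<exists>r l. strict_mono (r :: nat \<Rightarrow> nat) \<and> (w \<circ> r) \<longlonglongrightarrow> l \<and> l \<in> attractor \<tau> \<omega>"
proof -
  obtain r y l where r: "strict_mono (r :: nat \<Rightarrow> nat)" and "\<And>n. id (w (r n)) = id (y n)" "y \<longlonglongrightarrow> l"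
    using pullback_asymptotically_compact_inD
        [OF pullback_asymptotically_compact_in_id[OF asymptotically_compact] \<omega> B t w] by blast
  then have l: "(w \<circ> r) \<longlonglongrightarrow> l" by (simp add: o_def)
  have "filterlim (t \<circ> r) at_top sequentially"
    using filterlim_compose[OF t(2) filterlim_subseq[OF r]] by (simp add: o_def)
  then have "l \<in> attractor \<tau> \<omega>"
    by (rule limit_in_attractor[OF B \<omega> _ _ l]) (simp add: w)
  then show ?thesis using r l by blast
qed

section \<open>The attractor as a nonempty invariant subfamily of \<open>K\<close>\<close>

lemma K_nonempty: "\<omega> \<in> space M \<Longrightarrow> K \<tau> \<omega> \<noteq> {}"
  using closed_K by (simp add: closed_family_def)

lemma pullback_image_K_nonempty: "\<omega> \<in> space M \<Longrightarrow> pullback_image \<theta> \<phi> K t \<tau> \<omega> \<noteq> {}"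
  by (simp add: pullback_image_def K_nonempty shift_space)

lemma attractor_nonempty:
  assumes "\<omega> \<in> space M" shows "attractor \<tau> \<omega> \<noteq> {}"
proof -
  have "\<forall>n. \<exists>w. w \<in> pullback_image \<theta> \<phi> K (real n) \<tau> \<omega>"
    using pullback_image_K_nonempty[OF assms] by blast
  then obtain w where "\<And>n. w n \<in> pullback_image \<theta> \<phi> K (real n) \<tau> \<omega>" by metis
  then show ?thesis
    using subsequence_to_attractor[OF K_in assms _ filterlim_real_sequentially, of w \<tau>] by auto
qed

lemma attractor_subset_K:
  assumes "\<omega> \<in> space M" shows "attractor \<tau> \<omega> \<subseteq> K \<tau> \<omega>"
proof
  fix l assume "l \<in> attractor \<tau> \<omega>"
  then obtain t z where "\<And>n. 0 \<le> t n" and t: "filterlim t at_top sequentially"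
      and z: "\<And>n. z n \<in> pullback_image \<theta> \<phi> K (t n) \<tau> \<omega>" and lim: "z \<longlonglongrightarrow> l"
    unfolding attractor_def by (blast dest: omega_limitD)
  have "\<forall>\<^sub>F n in sequentially. z n \<in> K \<tau> \<omega>"
    using filterlim_iff[THEN iffD1, OF t, rule_format, OF absorbs[OF K_in assms, of \<tau>]]
    by eventually_elim (use z in blast)
  moreover have "closed (K \<tau> \<omega>)" using closed_K assms by (simp add: closed_family_def)
  ultimately show "l \<in> K \<tau> \<omega>" using Lim_in_closed_set[OF _ _ _ lim] by simp
qed

lemma attractor_in: "attractor \<in> \<D>"
  using inclusion_closed K_in attractor_nonempty attractor_subset_K
  unfolding inclusion_closed_def by blast

text \<open>Forward, continuity pushes approximating sequences through the cocycle. Backward, the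
  approximating points are pulled back by \<open>t\<close> units; a limit of the pulled-back points
  along a subsequence is the required preimage, again by continuity.\<close>

lemma attractor_invariant:
  assumes "0 \<le> t" and \<omega>: "\<omega> \<in> space M"
  shows "\<phi> t \<tau> \<omega> ` attractor \<tau> \<omega> = attractor (\<tau> + t) (\<theta> t \<omega>)"
proof
  have cont: "isCont (\<phi> t \<tau> \<omega>) l" for l
    using cocycle_continuous[OF assms] by (simp add: continuous_on_eq_continuous_at)
  show "\<phi> t \<tau> \<omega> ` attractor \<tau> \<omega> \<subseteq> attractor (\<tau> + t) (\<theta> t \<omega>)"
  proof
    fix y assume "y \<in> \<phi> t \<tau> \<omega> ` attractor \<tau> \<omega>"
    then obtain l where y: "y = \<phi> t \<tau> \<omega> l" and "l \<in> attractor \<tau> \<omega>" by blast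
    from this(2) obtain s z where s: "\<And>n. 0 \<le> s n" "filterlim s at_top sequentially"
        and z: "\<And>n. z n \<in> pullback_image \<theta> \<phi> K (s n) \<tau> \<omega>" and lim: "z \<longlonglongrightarrow> l"
      unfolding attractor_def by (blast dest: omega_limitD)
    have "filterlim (\<lambda>n. t + s n) at_top sequentially"
      by (rule filterlim_tendsto_add_at_top[OF tendsto_const s(2)])
    moreover have "\<phi> t \<tau> \<omega> (z n) \<in> pullback_image \<theta> \<phi> K (t + s n) (\<tau> + t) (\<theta> t \<omega>)" for n
      using pullback_image_add[OF assms(1) s(1) \<omega>] z by blast
    moreover have "(\<lambda>n. \<phi> t \<tau> \<omega> (z n)) \<longlonglongrightarrow> y"
      unfolding y by (rule isCont_tendsto_compose[OF cont lim])
    ultimately show "y \<in> attractor (\<tau> + t) (\<theta> t \<omega>)"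
      unfolding attractor_def by (rule omega_limitI)
  qed
  show "attractor (\<tau> + t) (\<theta> t \<omega>) \<subseteq> \<phi> t \<tau> \<omega> ` attractor \<tau> \<omega>"
  proof
    fix y assume "y \<in> attractor (\<tau> + t) (\<theta> t \<omega>)"
    then obtain s z where s: "\<And>n. 0 \<le> s n" "filterlim s at_top sequentially"
        and z: "\<And>n. z n \<in> pullback_image \<theta> \<phi> K (s n) (\<tau> + t) (\<theta> t \<omega>)" and lim: "z \<longlonglongrightarrow> y"
      unfolding attractor_def by (blast dest: omega_limitD)
    \<comment> \<open>After dropping \<open>N\<close> terms every run lasts at least
      \<open>t\<close> and can be cut \<open>t\<close> units before its end.\<close>
    obtain N where N: "\<And>n. N \<le> n \<Longrightarrow> t \<le> s n"
      using s(2) unfolding filterlim_at_top eventually_sequentially by blast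
    define s' where "s' n = s (n + N) - t" for n
    have s'0: "0 \<le> s' n" for n using N[of "n + N"] by (simp add: s'_def)
    have "filterlim (\<lambda>n. - t + s (n + N)) at_top sequentially"
      by (rule filterlim_tendsto_add_at_top[OF tendsto_const filterlim_compose[OF s(2) filterlim_add_const_nat_at_top]])
    then have s'lim: "filterlim s' at_top sequentially"
      by (simp add: s'_def[abs_def])
    have "z (n + N) \<in> \<phi> t \<tau> \<omega> ` pullback_image \<theta> \<phi> K (s' n) \<tau> \<omega>" for n
      using pullback_image_add[OF assms(1) s'0[of n] \<omega>, of K \<tau>] z[of "n + N"] by (simp add: s'_def)
    then have "\<forall>n. \<exists>w. w \<in> pullback_image \<theta> \<phi> K (s' n) \<tau> \<omega> \<and> \<phi> t \<tau> \<omega> w = z (n + N)"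
      by (metis imageE)
    then obtain w where w: "\<And>n. w n \<in> pullback_image \<theta> \<phi> K (s' n) \<tau> \<omega>" "\<And>n. \<phi> t \<tau> \<omega> (w n) = z (n + N)"
      by metis
    obtain r l where r: "strict_mono r" and l: "(w \<circ> r) \<longlonglongrightarrow> l" "l \<in> attractor \<tau> \<omega>"
      using subsequence_to_attractor[OF K_in \<omega> s'0 s'lim w(1)] by blast
    have "(\<lambda>n. \<phi> t \<tau> \<omega> ((w \<circ> r) n)) \<longlonglongrightarrow> \<phi> t \<tau> \<omega> l"
      by (rule isCont_tendsto_compose[OF cont l(1)])
    moreover have "(\<lambda>n. z (n + N)) \<longlonglongrightarrow> y" using lim by (rule LIMSEQ_ignore_initial_segment)
    then have "(\<lambda>n. \<phi> t \<tau> \<omega> ((w \<circ> r) n)) \<longlonglongrightarrow> y"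
      using LIMSEQ_subseq_LIMSEQ[OF _ r, of "\<lambda>n. z (n + N)" y] by (simp add: o_def w(2))
    ultimately have "y = \<phi> t \<tau> \<omega> l" by (metis LIMSEQ_unique)
    then show "y \<in> \<phi> t \<tau> \<omega> ` attractor \<tau> \<omega>" using l(2) by blast
  qed
qed

section \<open>Position inside the pullback images, and measurability\<close>

lemma pullback_image_attractor:
  assumes "0 \<le> t" "\<omega> \<in> space M"
  shows "pullback_image \<theta> \<phi> attractor t \<tau> \<omega> = attractor \<tau> \<omega>"
  by (rule pullback_image_invariant) (use assms attractor_invariant in auto)

lemma attractor_subset_pullback_image:
  assumes "0 \<le> t" "\<omega> \<in> space M"
  shows "attractor \<tau> \<omega> \<subseteq> pullback_image \<theta> \<phi> K t \<tau> \<omega>"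
  unfolding pullback_image_attractor[OF assms, symmetric] pullback_image_def
  by (intro image_mono attractor_subset_K shift_space assms)

text \<open>Integer times suffice: since the attractor is contained in every pullback image of \<open>K\<close>, the
  distances to these images are bounded by the distance to the attractor, and by asymptotic
  compactness they cannot stay below it.\<close>

lemma infdist_pullback_image_tendsto:
  assumes \<omega>: "\<omega> \<in> space M"
  shows "(\<lambda>m. infdist x (pullback_image \<theta> \<phi> K (real m) \<tau> \<omega>)) \<longlonglongrightarrow> infdist x (attractor \<tau> \<omega>)"
proof (rule order_tendstoI)
  let ?S = "\<lambda>m. pullback_image \<theta> \<phi> K (real m) \<tau> \<omega>"
  have le: "infdist x (?S m) \<le> infdist x (attractor \<tau> \<omega>)" for m
    by (rule infdist_mono) (use attractor_subset_pullback_image attractor_nonempty \<omega> in auto)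
  show "\<forall>\<^sub>F m in sequentially. infdist x (?S m) < a" if "infdist x (attractor \<tau> \<omega>) < a" for a
    using le that by (intro always_eventually) (meson le_less_trans)
  show "\<forall>\<^sub>F m in sequentially. a < infdist x (?S m)" if a: "a < infdist x (attractor \<tau> \<omega>)" for a
  proof (rule ccontr)
    \<comment> \<open>A distance at most \<open>a\<close> need not be attained; below
      \<open>b\<close> there are actual points, and their limit still has distance at most
      \<open>b\<close>.\<close>
    obtain b where b: "a < b" "b < infdist x (attractor \<tau> \<omega>)" using dense[OF a] by blast
    assume "\<not> ?thesis"
    then have "\<forall>n. \<exists>m\<ge>n. infdist x (?S m) \<le> a"
      by (auto simp: eventually_sequentially not_less)
    then obtain m where m: "\<And>n. n \<le> m n" "\<And>n. infdist x (?S (m n)) \<le> a" by metis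
    have "\<exists>w\<in>?S (m n). dist x w < b" for n
      using le_less_trans[OF m(2)[of n] b(1)]
      by (simp add: infdist_less_iff pullback_image_K_nonempty[OF \<omega>])
    then obtain w where w: "\<And>n. w n \<in> ?S (m n)" "\<And>n. dist x (w n) < b" by metis
    have "filterlim (\<lambda>n. real (m n)) at_top sequentially"
      by (rule filterlim_at_top_mono[OF filterlim_real_sequentially]) (simp add: m)
    then obtain r l where l: "(w \<circ> r) \<longlonglongrightarrow> l" "l \<in> attractor \<tau> \<omega>"
      using subsequence_to_attractor[of K \<omega> "\<lambda>n. real (m n)" w \<tau>] K_in \<omega> w(1) by auto
    have "(\<lambda>n. dist x ((w \<circ> r) n)) \<longlonglongrightarrow> dist x l"
      by (intro tendsto_intros l)
    then have "dist x l \<le> b"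
      by (rule LIMSEQ_le_const2) (auto intro: less_imp_le w)
    then show False using infdist_le[OF l(2), of x] b by simp
  qed
qed

lemma measurable_attractor: "measurable_family (completion M) attractor"
  unfolding measurable_family_def
proof (intro allI)
  fix x \<tau>
  show "(\<lambda>\<omega>. infdist x (attractor \<tau> \<omega>)) \<in> borel_measurable (completion M)"
  proof (rule borel_measurable_LIMSEQ_real)
    show "(\<lambda>m. infdist x (pullback_image \<theta> \<phi> K (real m) \<tau> \<omega>)) \<longlonglongrightarrow> infdist x (attractor \<tau> \<omega>)"
      if "\<omega> \<in> space (completion M)" for \<omega>
      using that infdist_pullback_image_tendsto by simp
  next
    fix m :: nat
    \<comment> \<open>Measurability is first shown as a function of the starting sample point. The
      shift back by \<open>m\<close> is composed in afterwards, as a map between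
      completions.\<close>
    have "(\<lambda>\<omega>. infdist x (\<phi> m (\<tau> - m) \<omega> ` K (\<tau> - m) \<omega>)) \<in> borel_measurable (completion M)"
    proof (rule borel_measurable_infdist_image)
      show "(\<lambda>\<omega>. infdist q (K (\<tau> - m) \<omega>)) \<in> borel_measurable (completion M)" for q
        using measurable_K by (simp add: measurable_family_def)
      show "(\<lambda>\<omega>. \<phi> m (\<tau> - m) \<omega> k) \<in> borel_measurable (completion M)" for k
        by (intro measurable_completion cocycle_measurable_at) simp
    qed (auto simp: K_nonempty cocycle_continuous)
    from measurable_compose[OF measurable_completion_completion this,
        OF shift_measurable_at shift_preserving]
    show "(\<lambda>\<omega>. infdist x (pullback_image \<theta> \<phi> K (real m) \<tau> \<omega>)) \<in> borel_measurable (completion M)"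
      by (simp add: pullback_image_def)
  qed
qed

text \<open>Any sequence of points from late pullback images has a subsequence converging in both
  spaces, with limits that agree by \<open>compatible\<close>. In the form \<open>subseq\<close>
  this gives compactness and attraction in \<open>Y\<close> and one inclusion between the
  omega-limit sets.\<close>

lemma attractor_trace:
  fixes jX :: "'x \<Rightarrow> 'e" and jY :: "'y::real_normed_vector \<Rightarrow> 'e"
  assumes inj: "inj jX" "inj jY"
    and smoothing: "\<forall>t>0. \<forall>\<tau>. \<forall>\<omega>\<in>space M. \<forall>x. jX (\<phi> t \<tau> \<omega> x) \<in> range jY"
    and compatible: "\<forall>u v x y. (\<forall>n::nat. jX (u n) = jY (v n)) \<and> u \<longlonglongrightarrow> x \<and> v \<longlonglongrightarrow> y \<longrightarrow> jX x = jY y"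
    and ac: "pullback_asymptotically_compact_in jX jY M \<theta> \<phi> \<D>"
  shows "pullback_attractor_in jX jY M \<theta> \<phi> \<D> attractor"
    and "\<omega> \<in> space M \<Longrightarrow> jX ` attractor \<tau> \<omega> \<subseteq> range jY"
    and "\<omega> \<in> space M \<Longrightarrow>
      omega_limit (\<lambda>t. trace_in jX jY (pullback_image \<theta> \<phi> K t \<tau> \<omega>)) = trace_in jX jY (attractor \<tau> \<omega>)"
proof -
  have image: "jX ` pullback_image \<theta> \<phi> B t \<tau> \<omega> \<subseteq> range jY" if "0 < t" "\<omega> \<in> space M" for B t \<tau> \<omega>
    using that smoothing shift_space by (auto simp: pullback_image_def)
  show range: "jX ` attractor \<tau> \<omega> \<subseteq> range jY" if "\<omega> \<in> space M" for \<tau> \<omega>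
    \<comment> \<open>Time 1 stands for any positive time: the attractor is its own pullback image,
      and \<open>smoothing\<close> puts that image into \<open>Y\<close>.\<close>
    using image[of 1 \<omega> attractor \<tau>] that by (simp add: pullback_image_attractor)

  have subseq: "\<exists>r l. strict_mono (r :: nat \<Rightarrow> nat) \<and> (z \<circ> r) \<longlonglongrightarrow> l \<and> l \<in> trace_in jX jY (attractor \<tau> \<omega>)"
    if B: "B \<in> \<D>" and \<omega>: "\<omega> \<in> space M" and t: "\<And>n. 0 \<le> t n" "filterlim t at_top sequentially"
      and z: "\<And>n. z n \<in> trace_in jX jY (pullback_image \<theta> \<phi> B (t n) \<tau> \<omega>)" for B t \<tau> \<omega> z
  proof -
    have "\<forall>n. \<exists>w. w \<in> pullback_image \<theta> \<phi> B (t n) \<tau> \<omega> \<and> jX w = jY (z n)"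
      using z by (fastforce simp: trace_in_def)
    then obtain w where w: "\<And>n. w n \<in> pullback_image \<theta> \<phi> B (t n) \<tau> \<omega>" "\<And>n. jX (w n) = jY (z n)"
      by metis
    obtain r l where r: "strict_mono (r :: nat \<Rightarrow> nat)" and l: "(w \<circ> r) \<longlonglongrightarrow> l" "l \<in> attractor \<tau> \<omega>"
      using subsequence_to_attractor[OF B \<omega> t w(1)] by blast
    have tr: "filterlim (t \<circ> r) at_top sequentially"
      using filterlim_compose[OF t(2) filterlim_subseq[OF r]] by (simp add: o_def)
    \<comment> \<open>The second extraction is made from the subsequence already converging in
      \<open>X\<close>, so both limits belong to one sequence. Injectivity of \<open>jY\<close> then
      identifies \<open>y\<close> as a subsequence of \<open>z\<close>.\<close>
    obtain r' y l' where r': "strict_mono (r' :: nat \<Rightarrow> nat)"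
        and y: "\<And>n. jX ((w \<circ> r) (r' n)) = jY (y n)" "y \<longlonglongrightarrow> l'"
      using pullback_asymptotically_compact_inD[OF ac \<omega> B _ tr, of "w \<circ> r" \<tau>] t(1) w(1)
      by auto
    have "y n = (z \<circ> (r \<circ> r')) n" for n
      using y(1)[of n] w(2) inj(2) by (simp add: inj_eq)
    then have z_eq: "z \<circ> (r \<circ> r') = y" by auto
    have "jX l = jY l'"
      using compatible[rule_format, of "(w \<circ> r) \<circ> r'" y l l'] y LIMSEQ_subseq_LIMSEQ[OF l(1) r'] by simp
    then have "l' \<in> trace_in jX jY (attractor \<tau> \<omega>)"
      using l(2) by (auto simp: trace_in_def intro: image_eqI[OF sym])
    then show ?thesis
      using z_eq y(2) strict_mono_o[OF r r'] by blast
  qed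

  show trace: "omega_limit (\<lambda>t. trace_in jX jY (pullback_image \<theta> \<phi> K t \<tau> \<omega>)) = trace_in jX jY (attractor \<tau> \<omega>)"
    (is "?L = ?R") if \<omega>: "\<omega> \<in> space M" for \<tau> \<omega>
  proof
    show "?L \<subseteq> ?R"
    proof
      fix y assume "y \<in> ?L"
      then obtain t z where tz: "\<And>n. 0 \<le> t n" "filterlim t at_top sequentially"
          "\<And>n. z n \<in> trace_in jX jY (pullback_image \<theta> \<phi> K (t n) \<tau> \<omega>)" "z \<longlonglongrightarrow> y"
        by (blast dest: omega_limitD)
      then obtain r l where "strict_mono (r :: nat \<Rightarrow> nat)" "(z \<circ> r) \<longlonglongrightarrow> l" "l \<in> ?R"
        using subseq[OF K_in \<omega>] by blast
      then show "y \<in> ?R"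
        using LIMSEQ_subseq_LIMSEQ[OF tz(4)] LIMSEQ_unique by blast
    qed
    show "?R \<subseteq> ?L"
    proof
      fix y assume "y \<in> ?R"
      then obtain x where xy: "jX x = jY y" and "x \<in> attractor \<tau> \<omega>"
        by (force simp: trace_in_def)
      from this(2) obtain t w where t: "\<And>n. 0 \<le> t n" "filterlim t at_top sequentially"
          and w: "\<And>n. w n \<in> pullback_image \<theta> \<phi> K (t n) \<tau> \<omega>" "w \<longlonglongrightarrow> x"
        unfolding attractor_def by (blast dest: omega_limitD)
      \<comment> \<open>The sequence \<open>w\<close> approximates \<open>x\<close> in
        \<open>X\<close>; a subsequence also converges in \<open>Y\<close>, and compatibility forces
        its limit to be \<open>y\<close>.\<close>
      obtain r v l where r: "strict_mono (r :: nat \<Rightarrow> nat)"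
          and v: "\<And>n. jX (w (r n)) = jY (v n)" "v \<longlonglongrightarrow> l"
        using pullback_asymptotically_compact_inD[OF ac \<omega> K_in t w(1)] by blast
      have "jX x = jY l"
        using compatible[rule_format, of "w \<circ> r" v x l] v LIMSEQ_subseq_LIMSEQ[OF w(2) r] by simp
      then have "y = l" using xy inj(2) by (simp add: inj_eq)
      have tr: "filterlim (t \<circ> r) at_top sequentially"
        using filterlim_compose[OF t(2) filterlim_subseq[OF r]] by (simp add: o_def)
      have v': "v n \<in> trace_in jX jY (pullback_image \<theta> \<phi> K ((t \<circ> r) n) \<tau> \<omega>)" for n
        using w(1)[of "r n"] v(1)[of n] by (auto simp: trace_in_def intro: image_eqI[OF sym])
      show "y \<in> ?L"
        unfolding \<open>y = l\<close> by (rule omega_limitI[OF tr _ v(2)]) (rule v')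
    qed
  qed

  show "pullback_attractor_in jX jY M \<theta> \<phi> \<D> attractor"
    unfolding pullback_attractor_in_def
  proof (intro conjI allI ballI impI)
    fix \<tau> \<omega> assume \<omega>: "\<omega> \<in> space M"
    show "jX ` attractor \<tau> \<omega> \<subseteq> range jY" using range \<omega> .
    \<comment> \<open>Compactness is obtained by writing the trace as an omega-limit set in
      \<open>Y\<close>.\<close>
    show "compact (trace_in jX jY (attractor \<tau> \<omega>))"
      unfolding trace[OF \<omega>, symmetric]
      by (rule compact_omega_limit) (use subseq[OF K_in \<omega>] in blast)
  next
    fix t \<tau> \<omega> assume "0 \<le> (t::real)" "\<omega> \<in> space M"
    then show "\<phi> t \<tau> \<omega> ` attractor \<tau> \<omega> = attractor (\<tau> + t) (\<theta> t \<omega>)"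
      by (rule attractor_invariant)
  next
    fix B \<tau> \<omega> assume B: "B \<in> \<D>" and \<omega>: "\<omega> \<in> space M"
    show "\<forall>\<^sub>F t in at_top. jX ` pullback_image \<theta> \<phi> B t \<tau> \<omega> \<subseteq> range jY"
      using eventually_gt_at_top[of 0] by eventually_elim (rule image[OF _ \<omega>])
    show "((\<lambda>t. hausdorff_semidist (trace_in jX jY (pullback_image \<theta> \<phi> B t \<tau> \<omega>))
        (trace_in jX jY (attractor \<tau> \<omega>))) \<longlongrightarrow> 0) at_top"
      by (rule hausdorff_semidist_tendsto_0) (rule subseq[OF B \<omega>])
  qed (rule attractor_in measurable_attractor)+
qed

text \<open>With both embeddings equal to \<open>id\<close>, smoothing is trivial and compatibility
  is uniqueness of limits.\<close>

lemma pullback_attractor_attractor: "pullback_attractor M \<theta> \<phi> \<D> attractor"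
proof -
  have "pullback_attractor_in id id M \<theta> \<phi> \<D> attractor"
  proof (rule attractor_trace(1))
    show "\<forall>u v x y. (\<forall>n::nat. id (u n) = id (v n)) \<and> u \<longlonglongrightarrow> x \<and> v \<longlonglongrightarrow> y \<longrightarrow> id x = id (y::'x)"
      unfolding id_apply by (metis LIMSEQ_unique ext)
  qed (auto intro: pullback_asymptotically_compact_in_id asymptotically_compact)
  then show ?thesis by (simp add: pullback_attractor_in_id)
qed

end

theorem theorem2p6:
  fixes M :: "'w measure"
    and \<theta> :: "real \<Rightarrow> 'w \<Rightarrow> 'w"
    and \<phi> :: "real \<Rightarrow> real \<Rightarrow> 'w \<Rightarrow> 'x \<Rightarrow> 'x::{banach, second_countable_topology}"
    and jX :: "'x \<Rightarrow> 'e"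
    and jY :: "'y::{banach, second_countable_topology} \<Rightarrow> 'e"
    and \<D> :: "('w, 'x) family set"
    and K :: "('w, 'x) family"
  defines "A\<^sub>X \<equiv> \<lambda>\<tau> \<omega>. \<Inter>s\<in>{0<..}. closure (\<Union>t\<in>{s..}. pullback_image \<theta> \<phi> K t \<tau> \<omega>)"
    and "A\<^sub>Y \<equiv> \<lambda>\<tau> \<omega>. \<Inter>s\<in>{0<..}. closure (\<Union>t\<in>{s..}. trace_in jX jY (pullback_image \<theta> \<phi> K t \<tau> \<omega>))"
  assumes "inj jX" and "inj jY" and "range jX \<inter> range jY \<noteq> {}"
    and "nonempty_families M \<D>" and "inclusion_closed M \<D>"
    and "continuous_cocycle M \<theta> \<phi>"
    and "closed_family M K" and "measurable_family (completion M) K"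
    and "pullback_absorbing M \<theta> \<phi> \<D> K"
    and "pullback_asymptotically_compact M \<theta> \<phi> \<D>"
  shows "pullback_attractor M \<theta> \<phi> \<D> A\<^sub>X \<and>
    (\<forall>A. pullback_attractor M \<theta> \<phi> \<D> A \<longrightarrow> (\<forall>\<tau>. \<forall>\<omega>\<in>space M. A \<tau> \<omega> = A\<^sub>X \<tau> \<omega>)) \<and>
    ((\<forall>t>0. \<forall>\<tau>. \<forall>\<omega>\<in>space M. \<forall>x. jX (\<phi> t \<tau> \<omega> x) \<in> range jX \<inter> range jY) \<and>
     (\<forall>u v x y. (\<forall>n::nat. jX (u n) = jY (v n)) \<and> u \<longlonglongrightarrow> x \<and> v \<longlonglongrightarrow> y \<longrightarrow> jX x = jY y) \<and>
     pullback_asymptotically_compact_in jX jY M \<theta> \<phi> \<D> \<longrightarrow>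
     (\<exists>A. pullback_attractor_in jX jY M \<theta> \<phi> \<D> A \<and>
        (\<forall>A'. pullback_attractor_in jX jY M \<theta> \<phi> \<D> A' \<longrightarrow> (\<forall>\<tau>. \<forall>\<omega>\<in>space M. A' \<tau> \<omega> = A \<tau> \<omega>)) \<and>
        (\<forall>\<tau>. \<forall>\<omega>\<in>space M. jX ` A \<tau> \<omega> = jY ` A\<^sub>Y \<tau> \<omega>)) \<and>
     (\<forall>\<tau>. \<forall>\<omega>\<in>space M. jY ` A\<^sub>Y \<tau> \<omega> = jX ` A\<^sub>X \<tau> \<omega> \<and> jX ` A\<^sub>X \<tau> \<omega> \<subseteq> range jX \<inter> range jY))"
proof -
  interpret absorbed_cocycle M \<theta> \<phi> \<D> K
    using assms by (intro absorbed_cocycle.intro absorbed_cocycle_axioms.intro)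
  have AX: "A\<^sub>X = attractor"
    by (intro ext) (simp add: A\<^sub>X_def attractor_def omega_limit_def)
  have uniq: "\<forall>\<tau>. \<forall>\<omega>\<in>space M. A \<tau> \<omega> = attractor \<tau> \<omega>" if "pullback_attractor M \<theta> \<phi> \<D> A" for A
    using that pullback_attractor_attractor pullback_attractor_in_subset[of id id \<D>]
    by (simp add: pullback_attractor_in_id subset_antisym)
  show ?thesis
    unfolding AX
  proof (intro conjI impI)
    show "pullback_attractor M \<theta> \<phi> \<D> attractor" by (rule pullback_attractor_attractor)
    show "\<forall>A. pullback_attractor M \<theta> \<phi> \<D> A \<longrightarrow> (\<forall>\<tau>. \<forall>\<omega>\<in>space M. A \<tau> \<omega> = attractor \<tau> \<omega>)"
      using uniq by blast
  next
    assume "(\<forall>t>0. \<forall>\<tau>. \<forall>\<omega>\<in>space M. \<forall>x. jX (\<phi> t \<tau> \<omega> x) \<in> range jX \<inter> range jY) \<and>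
     (\<forall>u v x y. (\<forall>n::nat. jX (u n) = jY (v n)) \<and> u \<longlonglongrightarrow> x \<and> v \<longlonglongrightarrow> y \<longrightarrow> jX x = jY y) \<and>
     pullback_asymptotically_compact_in jX jY M \<theta> \<phi> \<D>"
    then have smoothing: "\<forall>t>0. \<forall>\<tau>. \<forall>\<omega>\<in>space M. \<forall>x. jX (\<phi> t \<tau> \<omega> x) \<in> range jY"
      and compatible: "\<forall>u v x y. (\<forall>n::nat. jX (u n) = jY (v n)) \<and> u \<longlonglongrightarrow> x \<and> v \<longlonglongrightarrow> y \<longrightarrow> jX x = jY y"
      and ac: "pullback_asymptotically_compact_in jX jY M \<theta> \<phi> \<D>"
      by blast+
    note Y = attractor_trace[OF \<open>inj jX\<close> \<open>inj jY\<close> smoothing compatible ac]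
    \<comment> \<open>By the equality of omega-limit sets \<open>A\<^sub>Y\<close> is the trace of
      the attractor, and the trace loses no points because the attractor lies in
      \<open>Y\<close>.\<close>
    have AY: "jY ` A\<^sub>Y \<tau> \<omega> = jX ` attractor \<tau> \<omega>" if "\<omega> \<in> space M" for \<tau> \<omega>
    proof -
      have "A\<^sub>Y \<tau> \<omega> = trace_in jX jY (attractor \<tau> \<omega>)"
        using Y(3)[OF that] by (simp add: A\<^sub>Y_def omega_limit_def)
      then show ?thesis using Y(2)[OF that, of \<tau>] by (auto simp: trace_in_def)
    qed
    show "\<forall>\<tau>. \<forall>\<omega>\<in>space M. jY ` A\<^sub>Y \<tau> \<omega> = jX ` attractor \<tau> \<omega> \<and> jX ` attractor \<tau> \<omega> \<subseteq> range jX \<inter> range jY"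
      using AY Y(2) by blast
    show "\<exists>A. pullback_attractor_in jX jY M \<theta> \<phi> \<D> A \<and>
        (\<forall>A'. pullback_attractor_in jX jY M \<theta> \<phi> \<D> A' \<longrightarrow> (\<forall>\<tau>. \<forall>\<omega>\<in>space M. A' \<tau> \<omega> = A \<tau> \<omega>)) \<and>
        (\<forall>\<tau>. \<forall>\<omega>\<in>space M. jX ` A \<tau> \<omega> = jY ` A\<^sub>Y \<tau> \<omega>)"
    \<comment> \<open>An attractor in \<open>Y\<close> is encoded as a family in \<open>X\<close>,
      while \<open>A\<^sub>Y\<close> consists of subsets of \<open>'y\<close>. The witness is
      therefore the attractor in \<open>X\<close>, compared with \<open>A\<^sub>Y\<close> through
      the embeddings.\<close>
    proof (intro exI[of _ attractor] conjI allI impI ballI)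
      fix A' \<tau> \<omega> assume "pullback_attractor_in jX jY M \<theta> \<phi> \<D> A'" "\<omega> \<in> space M"
      then show "A' \<tau> \<omega> = attractor \<tau> \<omega>"
        using Y(1) pullback_attractor_in_subset[OF \<open>inj jX\<close> \<open>inj jY\<close>] by (simp add: subset_antisym)
    qed (use Y(1) AY in auto)
  qed
qed

end
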